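(* Let $n\ge 3$, $0<\mu<n$, $s\in(0,1)$, and let $\Omega\subset\mathbb{R}^n$ be an arbitrary (non-empty) open set. Then $S_{H,L,M}(\Omega)=S_{H,L,C}$.
   Context: Put $2_\mu^*=\frac{2n-\mu}{n-2}$ and $$\|u\|_{HL}=\left(\int_{\mathbb{R}^n}\int_{\mathbb{R}^n}\frac{|u(x)|^{2_\mu^*}|u(y)|^{2_\mu^*}}{|x-y|^\mu}\,dx\,dy\right)^{\frac{1}{2\cdot 2_\mu^*}} .$$ For measurable $u:\mathbb{R}^n\to\mathbb{R}$, $[u]_s^2=\frac{C(n,s)}{2}\int_{\mathbb{R}^n}\int_{\mathbb{R}^n}\frac{|u(x)-u(y)|^2}{|x-y|^{n+2s}}\,dx\,dy$, where $C(n,s)=\left(\int_{\mathbb{R}^n}\frac{1-\cos z_1}{|z|^{n+2s}}\,dz\right)^{-1}$. Put $\|u\|^2=\int_{\mathbb{R}^n}|\nabla u|^2dx$ and $\mathcal{G}(u)=\left(\|u\|^2+[u]_s^2\right)^{1/2}$. The mixed and classical constants are $$S_{H,L,M}(\Omega)=\inf_{u\in C_0^\infty(\Omega)\setminus\{0\}}\frac{\mathcal{G}(u)^2}{\|u\|_{HL}^2},\qquad S_{H,L,C}=\inf_{u\in C_0^\infty(\mathbb{R}^n)\setminus\{0\}}\frac{\|u\|^2}{\|u\|_{HL}^2},$$ where functions in $C_0^\infty(\Omega)$ are extended by $0$ to $\mathbb{R}^n$. *)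

theory Defs
  imports "HOL-Analysis.Analysis"
begin

text \<open>
  The space \<open>\<real>\<^sup>n\<close> is \<^typ>\<open>real ^ 'n\<close>, so that \<open>n = CARD('n)\<close>.  All integrals below have nonnegative
  integrands and are taken in \<open>[0, \<infinity>]\<close>; in particular a divergent integral has the value \<open>\<infinity>\<close>.
\<close>

text \<open>Real powers on \<open>[0, \<infinity>]\<close>; used with positive exponents only.\<close>

definition ennpowr :: "ennreal \<Rightarrow> real \<Rightarrow> ennreal"
  where "ennpowr x p = (if x = \<infinity> then \<infinity> else ennreal (enn2real x powr p))"

definition partial_deriv :: "'n::finite \<Rightarrow> (real ^ 'n \<Rightarrow> real) \<Rightarrow> real ^ 'n \<Rightarrow> real"
  where "partial_deriv i u x = frechet_derivative u (at x) (axis i 1)"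

definition gradient :: "(real ^ 'n::finite \<Rightarrow> real) \<Rightarrow> real ^ 'n \<Rightarrow> real ^ 'n"
  where "gradient u x = (\<chi> i. partial_deriv i u x)"

text \<open>
  Infinite differentiability: every iterated partial derivative, including \<open>u\<close> itself
  (the empty list), is differentiable, hence also continuous, at every point.
\<close>

definition smooth :: "(real ^ 'n::finite \<Rightarrow> real) \<Rightarrow> bool"
  where "smooth u \<longleftrightarrow> (\<forall>is x. foldr partial_deriv is u differentiable at x)"

text \<open>
  \<open>C\<^sub>0\<^sup>\<infinity>(\<Omega>)\<close>, with its members already extended by \<open>0\<close> to the whole space: for open \<open>\<Omega>\<close> these are
  exactly the smooth functions on \<open>\<real>\<^sup>n\<close> whose support is compact and contained in \<open>\<Omega>\<close>.
\<close>

definition test_functions :: "(real ^ 'n::finite) set \<Rightarrow> (real ^ 'n \<Rightarrow> real) set"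
  where "test_functions \<Omega> =
    {u. smooth u \<and> compact (closure (support_on UNIV u)) \<and> closure (support_on UNIV u) \<subseteq> \<Omega>}"

definition hl_exponent :: "nat \<Rightarrow> real \<Rightarrow> real"
  where "hl_exponent n \<mu> = (2 * real n - \<mu>) / (real n - 2)"

definition hl_norm :: "real \<Rightarrow> (real ^ 'n::finite \<Rightarrow> real) \<Rightarrow> ennreal"
  where "hl_norm \<mu> u =
    (let p = hl_exponent CARD('n) \<mu> in
      ennpowr
        (\<integral>\<^sup>+y. \<integral>\<^sup>+x. ennreal (\<bar>u x\<bar> powr p * \<bar>u y\<bar> powr p / norm (x - y) powr \<mu>) \<partial>lborel \<partial>lborel)
        (1 / (2 * p)))"

text \<open>
  \<open>C(n,s)\<close>.  The index type \<open>'n\<close> has no distinguished first element; the argument \<open>k\<close> names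
  the coordinate that is written \<open>z\<^sub>1\<close> in the usual definition.
\<close>

definition frac_const :: "'n::finite \<Rightarrow> real \<Rightarrow> ennreal"
  where "frac_const k s =
    inverse (\<integral>\<^sup>+z. ennreal ((1 - cos (z $ k)) / norm z powr (real CARD('n) + 2 * s))
      \<partial>(lborel :: (real ^ 'n) measure))"

text \<open>The square \<open>[u]\<^sub>s\<^sup>2\<close> of the Gagliardo seminorm.\<close>

definition gagliardo_sq :: "'n::finite \<Rightarrow> real \<Rightarrow> (real ^ 'n \<Rightarrow> real) \<Rightarrow> ennreal"
  where "gagliardo_sq k s u =
    frac_const k s / 2 *
    (\<integral>\<^sup>+y. \<integral>\<^sup>+x. ennreal (\<bar>u x - u y\<bar>\<^sup>2 / norm (x - y) powr (real CARD('n) + 2 * s))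
      \<partial>lborel \<partial>lborel)"

definition dirichlet_sq :: "(real ^ 'n::finite \<Rightarrow> real) \<Rightarrow> ennreal"
  where "dirichlet_sq u = (\<integral>\<^sup>+x. ennreal ((norm (gradient u x))\<^sup>2) \<partial>lborel)"

definition mixed_norm :: "'n::finite \<Rightarrow> real \<Rightarrow> (real ^ 'n \<Rightarrow> real) \<Rightarrow> ennreal"
  where "mixed_norm k s u = ennpowr (dirichlet_sq u + gagliardo_sq k s u) (1 / 2)"

definition S_HLM :: "'n::finite \<Rightarrow> real \<Rightarrow> real \<Rightarrow> (real ^ 'n) set \<Rightarrow> ennreal"
  where "S_HLM k s \<mu> \<Omega> =
    (INF u \<in> test_functions \<Omega> - {\<lambda>_. 0}. (mixed_norm k s u)\<^sup>2 / (hl_norm \<mu> u)\<^sup>2)"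

definition S_HLC :: "'n::finite itself \<Rightarrow> real \<Rightarrow> ennreal"
  where "S_HLC _ \<mu> =
    (INF u \<in> test_functions (UNIV :: (real ^ 'n) set) - {\<lambda>_. 0}. dirichlet_sq u / (hl_norm \<mu> u)\<^sup>2)"

end

theory Submission
  imports Defs
begin

text \<open>
  The mixed quotient is at least the classical one, and \<open>\<Omega>\<close> admits fewer competitors than the whole
  space, so \<open>S_HLC \<le> S_HLM\<close>.  The reverse inequality is a concentration argument.

  Given a test function \<open>u\<close> on the whole space and a ball around \<open>c\<close> inside \<open>\<Omega>\<close>, the function
  \<open>x \<mapsto> u ((x - c) / r)\<close> is a test function on \<open>\<Omega>\<close> for all small \<open>r > 0\<close>.  Its Dirichlet integral
  carries the factor \<open>r\<close> to the power \<open>n - 2\<close> (\<open>dirichlet_sq_rescale\<close>), the squared Gagliardo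
  seminorm \<open>r\<close> to the power \<open>n - 2s\<close> (\<open>gagliardo_sq_rescale\<close>), and, because the exponent is
  critical, the squared Hardy-Littlewood norm carries the same factor as the Dirichlet integral
  (\<open>hl_norm_rescale\<close>).  With \<open>D\<close>, \<open>G\<close> and \<open>H\<close> the three quantities for \<open>u\<close>, the mixed quotient of the
  rescaled function is therefore \<open>D / H + t (G / H)\<close>, where \<open>t\<close> is \<open>r\<close> to the power \<open>2 - 2s\<close>.
  Since \<open>s < 1\<close>, it tends to \<open>D / H\<close> as \<open>r \<rightarrow> 0\<close>, provided that \<open>G / H\<close> is finite.

  This proviso is the analytic content.  It needs \<open>H \<noteq> 0\<close> (\<open>hl_norm_nonzero\<close>) and \<open>G < \<infinity>\<close>
  (\<open>gagliardo_sq_finite\<close>).  For the latter, \<open>|u x - u y|\<^sup>2\<close> is at most a constant times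
  \<open>min 1 (|x - y|\<^sup>2)\<close> and vanishes unless \<open>x\<close> or \<open>y\<close> lies in a fixed ball, so everything reduces to the
  integrability of the truncated kernel (\<open>nn_integral_truncated_kernel\<close>), which is proved by
  a decomposition into dyadic shells.
\<close>

section \<open>Scaling and positivity of Lebesgue integrals\<close>

lemma nn_integral_lborel_rescale:
  fixes f :: "'a::euclidean_space \<Rightarrow> ennreal"
  assumes [measurable]: "f \<in> borel_measurable borel" and "r > 0"
  shows "(\<integral>\<^sup>+x. f ((x - c) /\<^sub>R r) \<partial>lborel) = ennreal (r ^ DIM('a)) * (\<integral>\<^sup>+x. f x \<partial>lborel)"
proof -
  have "(\<integral>\<^sup>+x. f ((x - c) /\<^sub>R r) \<partial>lborel) =
      (\<integral>\<^sup>+x. f ((x - c) /\<^sub>R r) \<partial>density (distr lborel borel (\<lambda>x. c + r *\<^sub>R x)) (\<lambda>_. \<bar>r\<bar> ^ DIM('a)))"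
    using lborel_affine[of r c] \<open>r > 0\<close> by simp
  also have "\<dots> = (\<integral>\<^sup>+x. ennreal (r ^ DIM('a)) * f x \<partial>lborel)"
    using \<open>r > 0\<close> by (simp add: nn_integral_density nn_integral_distr)
  also have "\<dots> = ennreal (r ^ DIM('a)) * (\<integral>\<^sup>+x. f x \<partial>lborel)"
    by (simp add: nn_integral_cmult)
  finally show ?thesis .
qed

lemma nn_integral_lborel_translate:
  fixes f :: "'a::euclidean_space \<Rightarrow> ennreal"
  assumes "f \<in> borel_measurable borel"
  shows "(\<integral>\<^sup>+x. f (x - c) \<partial>lborel) = (\<integral>\<^sup>+x. f x \<partial>lborel)"
  using nn_integral_lborel_rescale[OF assms, of 1 c] by simp

lemma double_nn_integral_lborel_rescale:
  fixes g :: "'a::euclidean_space \<Rightarrow> 'a \<Rightarrow> ennreal"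
  assumes g [measurable]: "case_prod g \<in> borel_measurable (borel \<Otimes>\<^sub>M borel)" and r: "r > 0"
  shows "(\<integral>\<^sup>+y. \<integral>\<^sup>+x. g ((x - c) /\<^sub>R r) ((y - c) /\<^sub>R r) \<partial>lborel \<partial>lborel) =
    ennreal (r ^ (2 * DIM('a))) * (\<integral>\<^sup>+y. \<integral>\<^sup>+x. g x y \<partial>lborel \<partial>lborel)"
proof -
  have [measurable]: "(\<lambda>x. g x y) \<in> borel_measurable borel" for y
    by measurable
  have [measurable]: "(\<lambda>y. \<integral>\<^sup>+x. g x y \<partial>lborel) \<in> borel_measurable borel"
    by measurable
  have "(\<integral>\<^sup>+y. \<integral>\<^sup>+x. g ((x - c) /\<^sub>R r) ((y - c) /\<^sub>R r) \<partial>lborel \<partial>lborel) =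
     (\<integral>\<^sup>+y. ennreal (r ^ DIM('a)) * (\<integral>\<^sup>+x. g x ((y - c) /\<^sub>R r) \<partial>lborel) \<partial>lborel)"
    using r by (intro nn_integral_cong nn_integral_lborel_rescale) auto
  also have "\<dots> = ennreal (r ^ DIM('a)) *
      (\<integral>\<^sup>+y. (\<integral>\<^sup>+x. g x ((y - c) /\<^sub>R r) \<partial>lborel) \<partial>lborel)"
    by (rule nn_integral_cmult) measurable
  also have "(\<integral>\<^sup>+y. (\<integral>\<^sup>+x. g x ((y - c) /\<^sub>R r) \<partial>lborel) \<partial>lborel) =
      ennreal (r ^ DIM('a)) * (\<integral>\<^sup>+y. \<integral>\<^sup>+x. g x y \<partial>lborel \<partial>lborel)"
    using r by (intro nn_integral_lborel_rescale) auto
  finally show ?thesis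
    using r by (simp add: mult.assoc[symmetric] ennreal_mult[symmetric] power_add[symmetric] mult_2)
qed

text \<open>
  A nonempty open set is not negligible.  Positivity on an open set is the form that suits singular
  kernels: on the diagonal they take the value \<open>0\<close>, as the result of a division by zero.
\<close>

lemma nn_integral_lborel_pos:
  fixes f :: "'a::euclidean_space \<Rightarrow> ennreal"
  assumes [measurable]: "f \<in> borel_measurable borel"
    and "open U" "U \<noteq> {}" and pos: "\<And>x. x \<in> U \<Longrightarrow> f x \<noteq> 0"
  shows "(\<integral>\<^sup>+x. f x \<partial>lborel) \<noteq> 0"
proof
  assume "(\<integral>\<^sup>+x. f x \<partial>lborel) = 0"
  then have "AE x in lborel. f x = 0"
    by (simp add: nn_integral_0_iff_AE)
  then have "AE x in lborel. x \<notin> U"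
    using pos by (auto elim: eventually_mono)
  then have "U \<in> null_sets lborel"
    using \<open>open U\<close> by (subst AE_iff_null_sets) auto
  then have "negligible U"
    by (simp add: negligible_iff_null_sets null_sets_completionI)
  with open_not_negligible assms show False by blast
qed

section \<open>Integrability of the truncated Gagliardo kernel\<close>

lemma dyadic_shell_ge_1:
  fixes t :: real
  assumes "1 \<le> t"
  obtains j :: nat where "2 ^ j \<le> t" "t \<le> 2 * 2 ^ j"
proof -
  define j where "j = nat \<lfloor>log 2 t\<rfloor>"
  have "0 \<le> log 2 t" using assms by simp
  then have "real j \<le> log 2 t" "log 2 t \<le> real (Suc j)"
    unfolding j_def by linarith+
  then have "2 powr real j \<le> t" "t \<le> 2 powr real (Suc j)"
    using assms by (simp_all add: le_log_iff log_le_iff)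
  then show ?thesis
    using that[of j] by (simp add: powr_realpow powr_add)
qed

text \<open>
  A substitute for polar coordinates.  On the shell \<open>a\<^sub>j \<le> |z| \<le> 2 a\<^sub>j\<close> the integrand is at
  most \<open>a\<^sub>j\<close> to the power \<open>-\<beta>\<close>, and the shell lies in a ball whose volume is a constant times the
  \<open>n\<close>-th power of \<open>a\<^sub>j\<close>, so the shells contribute a series of powers with exponent \<open>n - \<beta>\<close>.
  Shells with the radii \<open>2\<^sup>j\<close> then give integrability at infinity for \<open>\<beta> > n\<close>, and those with the
  reciprocal radii give integrability at the origin for \<open>\<beta> < n\<close>.
\<close>

lemma nn_integral_norm_powr_dyadic:
  fixes A :: "'a::euclidean_space set" and a :: "nat \<Rightarrow> real"
  assumes a: "\<And>j. a j > 0" and "\<beta> \<ge> 0"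
    and sm: "summable (\<lambda>j. a j powr (real DIM('a) - \<beta>))"
    and A: "\<And>z. z \<in> A \<Longrightarrow> \<exists>j. a j \<le> norm z \<and> norm z \<le> 2 * a j"
  shows "(\<integral>\<^sup>+z. ennreal (1 / norm z powr \<beta>) * indicator A z \<partial>lborel) < \<infinity>"
proof -
  define V where "V = unit_ball_vol (real DIM('a)) * 2 ^ DIM('a)"
  have V: "V \<ge> 0" by (simp add: V_def)
  have "(\<integral>\<^sup>+z. ennreal (1 / norm z powr \<beta>) * indicator A z \<partial>lborel)
      \<le> (\<integral>\<^sup>+z. (\<Sum>j. ennreal (1 / a j powr \<beta>) * indicator (cball (0::'a) (2 * a j)) z) \<partial>lborel)"
  proof (rule nn_integral_mono)
    fix z :: 'a
    show "ennreal (1 / norm z powr \<beta>) * indicator A z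
        \<le> (\<Sum>j. ennreal (1 / a j powr \<beta>) * indicator (cball (0::'a) (2 * a j)) z)" (is "_ \<le> suminf ?f")
    proof (cases "z \<in> A")
      case True
      have le_suminf: "g i \<le> suminf g" for g :: "nat \<Rightarrow> ennreal" and i
        using sum_le_suminf[of g "{i}"] by simp
      from True obtain j where j: "a j \<le> norm z" "norm z \<le> 2 * a j"
        using A by blast
      have "ennreal (1 / norm z powr \<beta>) * indicator A z \<le> ?f j"
        using j True a[of j] \<open>\<beta> \<ge> 0\<close>
        by (auto intro!: ennreal_leI divide_left_mono powr_mono2 mult_pos_pos)
      also have "?f j \<le> suminf ?f"
        by (rule le_suminf)
      finally show ?thesis .
    qed simp
  qed
  also have "\<dots> = (\<Sum>j. \<integral>\<^sup>+z. ennreal (1 / a j powr \<beta>) * indicator (cball (0::'a) (2 * a j)) z \<partial>lborel)"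
    by (intro nn_integral_suminf borel_measurable_times_ennreal borel_measurable_indicator) simp_all
  also have "\<dots> = (\<Sum>j. ennreal (V * a j powr (real DIM('a) - \<beta>)))"
  proof (intro suminf_cong)
    fix j
    have "(\<integral>\<^sup>+z. ennreal (1 / a j powr \<beta>) * indicator (cball (0::'a) (2 * a j)) z \<partial>lborel)
      = ennreal (1 / a j powr \<beta>) * emeasure lborel (cball (0::'a) (2 * a j))"
      by (subst nn_integral_cmult_indicator) auto
    also have "\<dots> = ennreal (1 / a j powr \<beta> * (unit_ball_vol (real DIM('a)) * (2 * a j) ^ DIM('a)))"
      using a[of j] by (simp add: emeasure_cball ennreal_mult[symmetric])
    also have "1 / a j powr \<beta> * (unit_ball_vol (real DIM('a)) * (2 * a j) ^ DIM('a)) =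
        V * a j powr (real DIM('a) - \<beta>)"
      using a[of j] by (simp add: V_def powr_diff powr_realpow power_mult_distrib)
    finally show "(\<integral>\<^sup>+z. ennreal (1 / a j powr \<beta>) * indicator (cball (0::'a) (2 * a j)) z \<partial>lborel)
      = ennreal (V * a j powr (real DIM('a) - \<beta>))" .
  qed
  also have "\<dots> < \<infinity>"
    unfolding infinity_ennreal_def less_top[symmetric]
    by (intro ennreal_suminf_neq_top summable_mult sm mult_nonneg_nonneg V powr_ge_zero)
  finally show ?thesis .
qed

lemma nn_integral_norm_powr_outside_unit_ball:
  assumes "\<beta> > real DIM('a)"
  shows "(\<integral>\<^sup>+z. ennreal (1 / norm z powr \<beta>) * indicator {z::'a::euclidean_space. 1 \<le> norm z} z \<partial>lborel) < \<infinity>"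
proof (rule nn_integral_norm_powr_dyadic[where a = "\<lambda>j. 2 ^ j"])
  have "2 powr (real DIM('a) - \<beta>) < 2 powr 0"
    using assms by (intro powr_less_mono) auto
  then have "summable (\<lambda>j. (2 powr (real DIM('a) - \<beta>)) ^ j)"
    by (intro summable_geometric) simp
  then show "summable (\<lambda>j. (2 ^ j) powr (real DIM('a) - \<beta>) :: real)"
    by (simp add: powr_realpow[symmetric] powr_powr mult.commute)
next
  fix z :: 'a
  assume "z \<in> {z. 1 \<le> norm z}"
  then show "\<exists>j. 2 ^ j \<le> norm z \<and> norm z \<le> 2 * 2 ^ j"
    using dyadic_shell_ge_1[of "norm z"] by blast
next
  show "0 \<le> \<beta>"
    using assms by linarith
qed simp

lemma nn_integral_norm_powr_inside_unit_ball:
  assumes "0 \<le> \<beta>" "\<beta> < real DIM('a)"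
  shows "(\<integral>\<^sup>+z. ennreal (1 / norm z powr \<beta>) *
    indicator {z::'a::euclidean_space. z \<noteq> 0 \<and> norm z \<le> 1} z \<partial>lborel) < \<infinity>"
proof (rule nn_integral_norm_powr_dyadic[where a = "\<lambda>j. (1/2) ^ Suc j"])
  have "(1/2) powr (real DIM('a) - \<beta>) < (1/2) powr 0"
    using assms by (intro powr_less_mono') auto
  then have "summable (\<lambda>j. ((1/2) powr (real DIM('a) - \<beta>)) ^ j)"
    by (intro summable_geometric) simp
  then have "summable (\<lambda>j. ((1/2) powr (real DIM('a) - \<beta>)) ^ Suc j)"
    by (subst summable_Suc_iff)
  moreover have "((1/2) ^ j) powr e = ((1/2) powr e) ^ j" for e :: real and j
    by (induction j) (simp_all add: powr_mult powr_divide)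
  ultimately show "summable (\<lambda>j. ((1/2) ^ Suc j) powr (real DIM('a) - \<beta>) :: real)"
    by (simp only:)
next
  fix z :: 'a
  assume "z \<in> {z. z \<noteq> 0 \<and> norm z \<le> 1}"
  then have z: "0 < norm z" "1 \<le> 1 / norm z" by auto
  obtain j :: nat where "2 ^ j \<le> 1 / norm z" "1 / norm z \<le> 2 * 2 ^ j"
    using dyadic_shell_ge_1[OF z(2)] .
  then show "\<exists>j. (1/2) ^ Suc j \<le> norm z \<and> norm z \<le> 2 * (1/2) ^ Suc j"
    using z(1) by (intro exI[of _ j]) (auto simp: field_simps power_divide)
qed (simp_all add: assms)

text \<open>
  Near the origin the kernel has the order \<open>2 - 2s - n > -n\<close>, at infinity the order
  \<open>-n - 2s < -n\<close>; these two inequalities are where \<open>s < 1\<close> and \<open>0 < s\<close> enter.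
  The dimension is at least \<open>2\<close> so that the first order is negative.
\<close>

lemma nn_integral_truncated_kernel:
  assumes "2 \<le> DIM('a)" "0 < s" "s < 1"
  shows "(\<integral>\<^sup>+z. ennreal (min 1 ((norm z)\<^sup>2) / norm z powr (real DIM('a) + 2 * s))
    \<partial>(lborel :: 'a::euclidean_space measure)) < \<infinity>"
proof -
  let ?n = "real DIM('a)"
  let ?I = "\<lambda>z::'a. ennreal (1 / norm z powr (?n + 2 * s - 2)) * indicator {z. z \<noteq> 0 \<and> norm z \<le> 1} z"
  let ?O = "\<lambda>z::'a. ennreal (1 / norm z powr (?n + 2 * s)) * indicator {z. 1 \<le> norm z} z"
  have "(\<integral>\<^sup>+z. ennreal (min 1 ((norm z)\<^sup>2) / norm z powr (?n + 2 * s)) \<partial>(lborel :: 'a measure))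
      \<le> (\<integral>\<^sup>+z. ?I z + ?O z \<partial>lborel)"
  proof (rule nn_integral_mono)
    fix z :: 'a
    consider "z = 0" | "1 \<le> norm z" | "z \<noteq> 0" "norm z < 1" by fastforce
    then show "ennreal (min 1 ((norm z)\<^sup>2) / norm z powr (?n + 2 * s)) \<le> ?I z + ?O z"
    proof cases
      case 2
      have "ennreal (min 1 ((norm z)\<^sup>2) / norm z powr (?n + 2 * s)) \<le> ?O z"
        using 2 by (auto intro!: ennreal_leI divide_right_mono)
      then show ?thesis by (simp add: add_increasing)
    next
      case 3
      have "norm z powr (?n + 2 * s - 2) = norm z powr (?n + 2 * s) / (norm z)\<^sup>2"
        using 3 by (simp add: powr_diff)
      then have "min 1 ((norm z)\<^sup>2) / norm z powr (?n + 2 * s) \<le> 1 / norm z powr (?n + 2 * s - 2)"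
        using 3 by (auto intro!: divide_right_mono)
      then have "ennreal (min 1 ((norm z)\<^sup>2) / norm z powr (?n + 2 * s)) \<le> ?I z"
        using 3 by (auto intro!: ennreal_leI)
      then show ?thesis by (simp add: add_increasing2)
    qed simp
  qed
  also have "\<dots> = (\<integral>\<^sup>+z. ?I z \<partial>lborel) + (\<integral>\<^sup>+z. ?O z \<partial>lborel)"
    by (rule nn_integral_add) measurable
  also have "\<dots> < \<infinity>"
    using nn_integral_norm_powr_inside_unit_ball[where 'a='a and \<beta> = "?n + 2 * s - 2"]
      nn_integral_norm_powr_outside_unit_ball[where 'a='a and \<beta> = "?n + 2 * s"] assms
    by auto
  finally show ?thesis .
qed

text \<open>
  By symmetry both summands have the same integral, and when the indicator depends on the outer
  variable, the inner integral is a translate of \<open>\<integral>k\<close>.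
\<close>

lemma double_nn_integral_kernel_near_set:
  fixes k :: "'a::euclidean_space \<Rightarrow> ennreal"
  assumes [measurable]: "k \<in> borel_measurable borel" "B \<in> sets borel"
    and even: "\<And>z. k (- z) = k z"
  shows "(\<integral>\<^sup>+y. \<integral>\<^sup>+x. k (x - y) * (indicator B x + indicator B y) \<partial>lborel \<partial>lborel)
    = 2 * (emeasure lborel B * (\<integral>\<^sup>+z. k z \<partial>lborel))"
proof -
  have 1: "(\<integral>\<^sup>+y. \<integral>\<^sup>+x. k (x - y) * indicator B y \<partial>lborel \<partial>lborel) =
      emeasure lborel B * (\<integral>\<^sup>+z. k z \<partial>lborel)"
    by (simp add: nn_integral_multc nn_integral_lborel_translate nn_integral_cmult mult.commute)
  have "(\<integral>\<^sup>+y. \<integral>\<^sup>+x. k (x - y) * indicator B x \<partial>lborel \<partial>lborel) =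
      (\<integral>\<^sup>+x. \<integral>\<^sup>+y. k (x - y) * indicator B x \<partial>lborel \<partial>lborel)"
    by (rule lborel_pair.Fubini') measurable
  also have "\<dots> = (\<integral>\<^sup>+x. \<integral>\<^sup>+y. k (y - x) * indicator B x \<partial>lborel \<partial>lborel)"
    using even[of "_ - _"] by (intro nn_integral_cong) (simp only: minus_diff_eq)
  finally have 2: "(\<integral>\<^sup>+y. \<integral>\<^sup>+x. k (x - y) * indicator B x \<partial>lborel \<partial>lborel) =
      emeasure lborel B * (\<integral>\<^sup>+z. k z \<partial>lborel)"
    using 1 by simp
  have "(\<integral>\<^sup>+y. \<integral>\<^sup>+x. k (x - y) * (indicator B x + indicator B y) \<partial>lborel \<partial>lborel)
    = (\<integral>\<^sup>+y. (\<integral>\<^sup>+x. k (x - y) * indicator B x \<partial>lborel) + (\<integral>\<^sup>+x. k (x - y) * indicator B y \<partial>lborel) \<partial>lborel)"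
    by (simp add: distrib_left nn_integral_add)
  also have "\<dots> = 2 * (emeasure lborel B * (\<integral>\<^sup>+z. k z \<partial>lborel))"
    by (subst nn_integral_add) (simp_all add: 1 2 mult_2)
  finally show ?thesis .
qed

section \<open>Rescaled test functions\<close>

lemma smooth_differentiable:
  "smooth u \<Longrightarrow> u differentiable at x"
  unfolding smooth_def by (drule spec[of _ "[]"]) simp

lemma smooth_partial_deriv:
  "smooth u \<Longrightarrow> smooth (partial_deriv i u)"
  unfolding smooth_def
proof (intro allI)
  fix "is" x assume "\<forall>is x. foldr partial_deriv is u differentiable at x"
  then have "foldr partial_deriv (is @ [i]) u differentiable at x" by blast
  then show "foldr partial_deriv is (partial_deriv i u) differentiable at x" by simp
qed

lemma smooth_continuous_on: "smooth u \<Longrightarrow> continuous_on S u"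
  by (meson continuous_at_imp_continuous_on differentiable_imp_continuous_within smooth_differentiable)

lemma smooth_borel_measurable: "smooth u \<Longrightarrow> u \<in> borel_measurable borel"
  by (intro borel_measurable_continuous_onI smooth_continuous_on)

lemma gradient_borel_measurable:
  assumes "smooth u" shows "gradient u \<in> borel_measurable borel"
  unfolding gradient_def using assms
  by (intro borel_measurable_continuous_onI continuous_on_vec_lambda smooth_continuous_on smooth_partial_deriv)

definition rescale :: "'a::real_normed_vector \<Rightarrow> real \<Rightarrow> ('a \<Rightarrow> 'b) \<Rightarrow> 'a \<Rightarrow> 'b"
  where "rescale c r u = (\<lambda>x. u ((x - c) /\<^sub>R r))"

lemma has_derivative_rescale:
  fixes u :: "'a::real_normed_vector \<Rightarrow> real"
  assumes "u differentiable at ((x - c) /\<^sub>R r)"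
  shows "((\<lambda>x. a * rescale c r u x) has_derivative
    (\<lambda>h. a * frechet_derivative u (at ((x - c) /\<^sub>R r)) (h /\<^sub>R r))) (at x)"
proof -
  have "(u has_derivative frechet_derivative u (at ((x - c) /\<^sub>R r))) (at ((x - c) /\<^sub>R r))"
    using assms frechet_derivative_works by blast
  moreover have "((\<lambda>x. (x - c) /\<^sub>R r) has_derivative (\<lambda>h. h /\<^sub>R r)) (at x)"
    by (auto intro!: derivative_eq_intros)
  ultimately have "((\<lambda>x. u ((x - c) /\<^sub>R r)) has_derivative
      (\<lambda>h. frechet_derivative u (at ((x - c) /\<^sub>R r)) (h /\<^sub>R r))) (at x)"
    by (rule has_derivative_compose[rotated])
  then show ?thesis
    unfolding rescale_def by (rule has_derivative_mult_right)
qed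

lemma partial_deriv_rescale:
  assumes "\<And>x. u differentiable at x"
  shows "partial_deriv i (\<lambda>x. a * rescale c r u x) = (\<lambda>x. a / r * rescale c r (partial_deriv i u) x)"
proof
  fix x
  let ?D = "frechet_derivative u (at ((x - c) /\<^sub>R r))"
  have "linear ?D"
    using assms linear_frechet_derivative by blast
  then have "a * ?D (axis i 1 /\<^sub>R r) = a / r * ?D (axis i 1)"
    by (simp add: linear_cmul divide_inverse)
  moreover have "frechet_derivative (\<lambda>x. a * rescale c r u x) (at x) = (\<lambda>h. a * ?D (h /\<^sub>R r))"
    using has_derivative_rescale[OF assms] frechet_derivative_at by metis
  ultimately show "partial_deriv i (\<lambda>x. a * rescale c r u x) x = a / r * rescale c r (partial_deriv i u) x"
    by (simp add: partial_deriv_def rescale_def)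
qed

text \<open>
  Each partial derivative of a rescaled function is again a rescaled function, up to a factor
  \<open>1 / r\<close>; this closed form makes the induction for smoothness go through.
\<close>

lemma foldr_partial_deriv_rescale:
  assumes "smooth u"
  shows "foldr partial_deriv is (rescale c r u) =
    (\<lambda>x. (1 / r) ^ length is * rescale c r (foldr partial_deriv is u) x)"
proof (induction "is")
  case (Cons i "is")
  then show ?case
    using assms by (simp add: partial_deriv_rescale smooth_def)
qed simp

lemma smooth_rescale:
  assumes "smooth u" shows "smooth (rescale c r u)"
  unfolding smooth_def foldr_partial_deriv_rescale[OF assms]
proof (intro allI)
  fix "is" x
  have "foldr partial_deriv is u differentiable at ((x - c) /\<^sub>R r)"
    using assms by (simp add: smooth_def)
  from has_derivative_rescale[OF this]
  show "(\<lambda>x. (1 / r) ^ length is * rescale c r (foldr partial_deriv is u) x) differentiable at x"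
    by (rule differentiableI)
qed

lemma gradient_rescale:
  assumes "smooth u"
  shows "gradient (rescale c r u) x = gradient u ((x - c) /\<^sub>R r) /\<^sub>R r"
proof -
  have "partial_deriv i (rescale c r u) = (\<lambda>x. 1 / r * rescale c r (partial_deriv i u) x)" for i
    using partial_deriv_rescale[of u i 1 c r] smooth_differentiable[OF assms] by simp
  then show ?thesis
    by (simp add: gradient_def vec_eq_iff rescale_def divide_inverse)
qed

lemma test_function_smooth: "u \<in> test_functions \<Omega> \<Longrightarrow> smooth u"
  by (simp add: test_functions_def)

lemma test_function_bounded_support:
  assumes "u \<in> test_functions \<Omega>"
  obtains R where "R > 0" "\<And>x. u x \<noteq> 0 \<Longrightarrow> norm x \<le> R"
proof -
  have "bounded (closure (support_on UNIV u))"
    using assms by (auto simp: test_functions_def compact_imp_bounded)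
  then obtain R where "R > 0" and R: "\<forall>x\<in>closure (support_on UNIV u). norm x \<le> R"
    by (metis bounded_pos)
  moreover have "norm x \<le> R" if "u x \<noteq> 0" for x
    using R closure_subset[of "support_on UNIV u"] that by (auto simp: support_on_def)
  ultimately show ?thesis using that by blast
qed

lemma rescale_test_function:
  assumes u: "smooth u" "\<And>x. u x \<noteq> 0 \<Longrightarrow> norm x \<le> R" and "0 < r" "cball c (r * R) \<subseteq> \<Omega>"
  shows "rescale c r u \<in> test_functions \<Omega>"
proof -
  have "support_on UNIV (rescale c r u) \<subseteq> cball c (r * R)"
  proof
    fix x assume "x \<in> support_on UNIV (rescale c r u)"
    then have "inverse r * norm (x - c) \<le> R"
      using u(2)[of "(x - c) /\<^sub>R r"] \<open>0 < r\<close> by (simp add: support_on_def rescale_def)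
    then show "x \<in> cball c (r * R)"
      using \<open>0 < r\<close> by (simp add: dist_norm norm_minus_commute field_simps)
  qed
  then have "closure (support_on UNIV (rescale c r u)) \<subseteq> cball c (r * R)"
    by (simp add: closure_minimal)
  then show ?thesis
    unfolding test_functions_def using assms(4) smooth_rescale[OF u(1)]
    by (auto simp: compact_eq_bounded_closed intro: bounded_subset[OF bounded_cball])
qed

lemma rescale_nonzero:
  assumes "u \<noteq> (\<lambda>_. 0)" "r \<noteq> 0"
  shows "rescale c r u \<noteq> (\<lambda>_. 0)"
proof -
  obtain z where "u z \<noteq> 0" using assms by auto
  then have "rescale c r u (c + r *\<^sub>R z) \<noteq> 0"
    using assms by (simp add: rescale_def)
  then show ?thesis by metis
qed

section \<open>Scaling of the energies and of the Hardy-Littlewood norm\<close>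

lemma dirichlet_sq_rescale:
  fixes u :: "real ^ 'n::finite \<Rightarrow> real"
  assumes "smooth u" "r > 0"
  shows "dirichlet_sq (rescale c r u) = ennreal (r powr (real CARD('n) - 2)) * dirichlet_sq u"
proof -
  note [measurable] = gradient_borel_measurable[OF assms(1)]
  have "dirichlet_sq (rescale c r u) =
      (\<integral>\<^sup>+x. ennreal (1 / r\<^sup>2) * ennreal ((norm (gradient u ((x - c) /\<^sub>R r)))\<^sup>2) \<partial>lborel)"
    unfolding dirichlet_sq_def gradient_rescale[OF assms(1)] using assms(2)
    by (intro nn_integral_cong)
       (simp add: power_mult_distrib power_inverse ennreal_mult[symmetric] divide_inverse)
  also have "\<dots> = ennreal (1 / r\<^sup>2) * (ennreal (r ^ CARD('n)) * dirichlet_sq u)"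
    unfolding dirichlet_sq_def using assms(2)
    by (subst nn_integral_cmult, measurable)
       (subst nn_integral_lborel_rescale[of "\<lambda>x. ennreal ((norm (gradient u x))\<^sup>2)"], auto)
  also have "\<dots> = ennreal (r powr (real CARD('n) - 2)) * dirichlet_sq u"
    using assms(2)
    by (simp add: mult.assoc[symmetric] ennreal_mult[symmetric] powr_diff powr_realpow)
  finally show ?thesis .
qed

text \<open>
  The Gagliardo integral (with \<open>F a b = |a - b|\<^sup>2\<close>) and the Hardy-Littlewood integral (with
  \<open>F a b\<close> the product of powers of \<open>|a|\<close> and \<open>|b|\<close>) scale alike: the two measures give the factor
  \<open>r\<close> to the power \<open>2n\<close>, and the homogeneous kernel gives \<open>r\<close> to the power \<open>-\<beta>\<close>.
\<close>

lemma riesz_double_integral_rescale: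
  fixes u :: "'a::euclidean_space \<Rightarrow> real" and F :: "real \<Rightarrow> real \<Rightarrow> real"
  assumes [measurable]: "u \<in> borel_measurable borel"
    and F [measurable]: "case_prod F \<in> borel_measurable (borel \<Otimes>\<^sub>M borel)"
    and r: "r > 0"
  shows "(\<integral>\<^sup>+y. \<integral>\<^sup>+x. ennreal (F (rescale c r u x) (rescale c r u y) / norm (x - y) powr \<beta>) \<partial>lborel \<partial>lborel)
    = ennreal (r powr (2 * real DIM('a) - \<beta>)) *
      (\<integral>\<^sup>+y. \<integral>\<^sup>+x. ennreal (F (u x) (u y) / norm (x - y) powr \<beta>) \<partial>lborel \<partial>lborel)"
proof -
  define g where "g x y = ennreal (F (u x) (u y) / norm (x - y) powr \<beta>)" for x y
  have Fu [measurable]: "(\<lambda>(x, y). F (u x) (u y)) \<in> borel_measurable (borel \<Otimes>\<^sub>M borel)"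
    using measurable_compose[OF _ F, of "\<lambda>(x, y). (u x, u y)"] by (simp add: case_prod_beta')
  have g [measurable]: "case_prod g \<in> borel_measurable (borel \<Otimes>\<^sub>M borel)"
    unfolding g_def using Fu by (simp add: case_prod_beta')
  have [measurable]: "(\<lambda>x. g x y) \<in> borel_measurable borel" for y
    by measurable
  have eq: "ennreal (F (rescale c r u x) (rescale c r u y) / norm (x - y) powr \<beta>) =
      ennreal (r powr - \<beta>) * g ((x - c) /\<^sub>R r) ((y - c) /\<^sub>R r)" for x y
  proof -
    have "norm (x - y) = r * norm ((x - c) /\<^sub>R r - (y - c) /\<^sub>R r)"
      using r by (simp add: scaleR_diff_right[symmetric] del: scaleR_diff_right)
    then have "norm (x - y) powr \<beta> = r powr \<beta> * norm ((x - c) /\<^sub>R r - (y - c) /\<^sub>R r) powr \<beta>"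
      using r by (metis less_imp_le norm_ge_zero powr_mult)
    then show ?thesis
      unfolding g_def rescale_def using r
      by (subst ennreal_mult'[symmetric]) (simp_all add: powr_minus field_simps)
  qed
  have "(\<integral>\<^sup>+y. \<integral>\<^sup>+x. ennreal (F (rescale c r u x) (rescale c r u y) / norm (x - y) powr \<beta>) \<partial>lborel \<partial>lborel)
    = ennreal (r powr - \<beta>) * (\<integral>\<^sup>+y. \<integral>\<^sup>+x. g ((x - c) /\<^sub>R r) ((y - c) /\<^sub>R r) \<partial>lborel \<partial>lborel)"
    unfolding eq by ((subst nn_integral_cmult, measurable)+)
  also have "\<dots> = ennreal (r powr - \<beta>) * (ennreal (r ^ (2 * DIM('a))) * (\<integral>\<^sup>+y. \<integral>\<^sup>+x. g x y \<partial>lborel \<partial>lborel))"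
    using double_nn_integral_lborel_rescale[OF g r] by simp
  also have "ennreal (r powr - \<beta>) * (ennreal (r ^ (2 * DIM('a))) * (\<integral>\<^sup>+y. \<integral>\<^sup>+x. g x y \<partial>lborel \<partial>lborel))
    = ennreal (r powr (2 * real DIM('a) - \<beta>)) * (\<integral>\<^sup>+y. \<integral>\<^sup>+x. g x y \<partial>lborel \<partial>lborel)"
  proof -
    have "r powr - \<beta> * r ^ (2 * DIM('a)) = r powr (2 * real DIM('a) - \<beta>)"
      using r by (simp add: powr_realpow[symmetric] powr_add[symmetric])
    then show ?thesis
      using r by (simp add: mult.assoc[symmetric] ennreal_mult[symmetric])
  qed
  finally show ?thesis unfolding g_def .
qed

lemma gagliardo_sq_rescale:
  fixes u :: "real ^ 'n::finite \<Rightarrow> real"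
  assumes "smooth u" "r > 0"
  shows "gagliardo_sq k s (rescale c r u) =
    ennreal (r powr (real CARD('n) - 2 * s)) * gagliardo_sq k s u"
proof -
  have "2 * real CARD('n) - (real CARD('n) + 2 * s) = real CARD('n) - 2 * s" by simp
  then show ?thesis
    unfolding gagliardo_sq_def
    using riesz_double_integral_rescale[where u = u and F = "\<lambda>a b. \<bar>a - b\<bar>\<^sup>2" and c = c
      and \<beta> = "real CARD('n) + 2 * s", OF smooth_borel_measurable[OF assms(1)] _ assms(2)]
    by (simp add: mult.left_commute)
qed

lemma ennpowr_mult:
  assumes "c > 0"
  shows "ennpowr (ennreal c * x) q = ennreal (c powr q) * ennpowr x q"
proof (cases "x = \<infinity>")
  case True
  then show ?thesis using assms by (simp add: ennpowr_def ennreal_mult_eq_top_iff)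
next
  case False
  then show ?thesis
    using assms by (simp add: ennpowr_def enn2real_mult ennreal_mult_eq_top_iff powr_mult ennreal_mult[symmetric])
qed

lemma ennpowr_half_power2: "(ennpowr x (1 / 2))\<^sup>2 = x"
proof (cases "x = \<infinity>")
  case False
  then have "(ennpowr x (1 / 2))\<^sup>2 = ennreal ((enn2real x powr (1 / 2))\<^sup>2)"
    by (simp add: ennpowr_def ennreal_power)
  also have "(enn2real x powr (1 / 2))\<^sup>2 = enn2real x"
    by (simp add: powr_half_sqrt)
  finally show ?thesis using False by (simp add: less_top)
qed (simp add: ennpowr_def)

lemma ennpowr_eq_0_iff: "ennpowr x q = 0 \<longleftrightarrow> x = 0"
  by (auto simp: ennpowr_def enn2real_eq_0_iff)

text \<open>
  The exponent \<open>p\<close> is critical: the double integral scales with the power \<open>2n - \<mu> = p (n - 2)\<close>, so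
  that the squared norm scales with the same power \<open>n - 2\<close> as the Dirichlet integral.
\<close>

lemma hl_norm_rescale:
  fixes u :: "real ^ 'n::finite \<Rightarrow> real"
  assumes "smooth u" "r > 0" and n: "CARD('n) \<ge> 3" "\<mu> < real CARD('n)"
  shows "(hl_norm \<mu> (rescale c r u))\<^sup>2 = ennreal (r powr (real CARD('n) - 2)) * (hl_norm \<mu> u)\<^sup>2"
proof -
  define p where "p = hl_exponent CARD('n) \<mu>"
  have p: "(2 * real CARD('n) - \<mu>) * (1 / (2 * p)) = (real CARD('n) - 2) / 2"
    using n by (simp add: p_def hl_exponent_def field_simps)
  have "hl_norm \<mu> (rescale c r u) = ennreal (r powr ((real CARD('n) - 2) / 2)) * hl_norm \<mu> u"
    unfolding hl_norm_def Let_def p_def[symmetric] p[symmetric]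
    using riesz_double_integral_rescale[where u = u and F = "\<lambda>a b. \<bar>a\<bar> powr p * \<bar>b\<bar> powr p" and c = c
      and \<beta> = \<mu>, OF smooth_borel_measurable[OF assms(1)] _ assms(2)] assms(2)
    by (simp add: ennpowr_mult powr_powr)
  moreover have "(r powr ((real CARD('n) - 2) / 2))\<^sup>2 = r powr (real CARD('n) - 2)"
    using assms(2) by (simp add: power2_eq_square powr_add[symmetric])
  ultimately show ?thesis
    by (simp add: power_mult_distrib ennreal_power)
qed

section \<open>Nonvanishing and finiteness\<close>

text \<open>
  The double integrand is positive off the diagonal of \<open>U \<times> U\<close>, where \<open>U\<close> is the open set on which
  \<open>u\<close> does not vanish.
\<close>

lemma hl_norm_nonzero:
  fixes u :: "real ^ 'n::finite \<Rightarrow> real"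
  assumes u: "smooth u" "u \<noteq> (\<lambda>_. 0)"
  shows "hl_norm \<mu> u \<noteq> 0"
proof -
  define p where "p = hl_exponent CARD('n) \<mu>"
  note [measurable] = smooth_borel_measurable[OF u(1)]
  define U where "U = {x. u x \<noteq> 0}"
  have "open U"
    unfolding U_def using smooth_continuous_on[OF u(1)] by (intro open_Collect_neq) auto
  have "U \<noteq> {}" using u(2) by (auto simp: U_def)
  have inner: "(\<integral>\<^sup>+x. ennreal (\<bar>u x\<bar> powr p * \<bar>u y\<bar> powr p / norm (x - y) powr \<mu>) \<partial>lborel) \<noteq> 0"
    if "y \<in> U" for y
  proof (rule nn_integral_lborel_pos)
    show "open (U - {y})" using \<open>open U\<close> by (rule open_delete)
    show "U - {y} \<noteq> {}"
      using \<open>open U\<close> \<open>y \<in> U\<close> not_open_singleton[of y] by (metis Diff_eq_empty_iff empty_iff subset_singletonD)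
  qed (use that in \<open>auto simp: U_def ennreal_eq_0_iff not_le\<close>)
  have "(\<integral>\<^sup>+y. \<integral>\<^sup>+x. ennreal (\<bar>u x\<bar> powr p * \<bar>u y\<bar> powr p / norm (x - y) powr \<mu>) \<partial>lborel \<partial>lborel) \<noteq> 0"
    by (rule nn_integral_lborel_pos[OF _ \<open>open U\<close> \<open>U \<noteq> {}\<close> inner]) measurable
  then show ?thesis
    by (simp add: hl_norm_def Let_def p_def[symmetric] ennpowr_eq_0_iff)
qed

text \<open>
  In \<open>[0, \<infinity>]\<close> the reciprocal of \<open>0\<close> is \<open>\<infinity>\<close>, so the finiteness of \<open>C(n,s)\<close> amounts to the positivity
  of the integral that it inverts.
\<close>

lemma frac_const_finite:
  "frac_const (k :: 'n::finite) s < \<infinity>"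
proof -
  define U where "U = {z :: real ^ 'n. 0 < z $ k \<and> z $ k < 1}"
  have "(\<integral>\<^sup>+z. ennreal ((1 - cos (z $ k)) / norm z powr (real CARD('n) + 2 * s))
      \<partial>(lborel :: (real ^ 'n) measure)) \<noteq> 0"
  proof (rule nn_integral_lborel_pos)
    show "open U"
      unfolding U_def by (intro open_Collect_conj open_Collect_less continuous_intros)
    have "axis k (1/2) \<in> U" by (simp add: U_def)
    then show "U \<noteq> {}" by auto
    fix z assume z: "z \<in> U"
    then have "cos (z $ k) < cos 0"
      using pi_gt3 by (intro cos_monotone_0_pi) (auto simp: U_def)
    moreover have "z \<noteq> 0" using z by (auto simp: U_def)
    ultimately show "ennreal ((1 - cos (z $ k)) / norm z powr (real CARD('n) + 2 * s)) \<noteq> 0"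
      by (simp add: ennreal_eq_0_iff not_le)
  qed measurable
  then show ?thesis
    by (simp add: frac_const_def less_top[symmetric])
qed

lemma smooth_Lipschitz_on_cball:
  fixes u :: "real ^ 'n::finite \<Rightarrow> real"
  assumes "smooth u"
  obtains L where "\<And>x y. x \<in> cball 0 R \<Longrightarrow> y \<in> cball 0 R \<Longrightarrow> \<bar>u x - u y\<bar> \<le> L * norm (x - y)"
proof -
  have "\<exists>b. \<forall>x\<in>cball 0 R. \<bar>partial_deriv i u x\<bar> \<le> b" for i
  proof -
    have "bounded (partial_deriv i u ` cball 0 R)"
      using assms by (intro compact_imp_bounded compact_continuous_image smooth_continuous_on
        smooth_partial_deriv) auto
    then show ?thesis by (auto simp: bounded_iff)
  qed
  then obtain b where b: "\<And>i x. x \<in> cball 0 R \<Longrightarrow> \<bar>partial_deriv i u x\<bar> \<le> b i"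
    by metis
  have "norm (u x - u y) \<le> (\<Sum>i\<in>UNIV. \<bar>b i\<bar>) * norm (x - y)"
    if xy: "x \<in> cball 0 R" "y \<in> cball 0 R" for x y
  proof (rule differentiable_bound[OF _ _ _ xy])
    show "convex (cball 0 R :: (real ^ 'n) set)" by simp
    fix x :: "real ^ 'n" assume x: "x \<in> cball 0 R"
    show D: "(u has_derivative frechet_derivative u (at x)) (at x within cball 0 R)"
      using smooth_differentiable[OF assms] frechet_derivative_works has_derivative_at_withinI by blast
    have lin: "linear (frechet_derivative u (at x))"
      using smooth_differentiable[OF assms] linear_frechet_derivative by blast
    show "onorm (frechet_derivative u (at x)) \<le> (\<Sum>i\<in>UNIV. \<bar>b i\<bar>)"
    proof (rule onorm_bound)
      fix h :: "real ^ 'n"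
      have "frechet_derivative u (at x) h = frechet_derivative u (at x) (\<Sum>i\<in>UNIV. h $ i *\<^sub>R axis i 1)"
        using basis_expansion[of h] by (simp add: scalar_mult_eq_scaleR)
      also have "\<dots> = (\<Sum>i\<in>UNIV. h $ i * partial_deriv i u x)"
        by (simp add: linear_sum[OF lin] linear_cmul[OF lin] partial_deriv_def)
      also have "norm \<dots> \<le> (\<Sum>i\<in>UNIV. norm h * \<bar>b i\<bar>)"
        by (rule sum_norm_le) (auto simp: abs_mult intro!: mult_mono component_le_norm_cart
          order_trans[OF b[OF x]])
      finally show "norm (frechet_derivative u (at x) h) \<le> (\<Sum>i\<in>UNIV. \<bar>b i\<bar>) * norm h"
        by (simp add: sum_distrib_left mult.commute)
    qed (simp add: sum_nonneg)
  qed
  then show ?thesis using that[of "\<Sum>i\<in>UNIV. \<bar>b i\<bar>"] by simp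
qed

text \<open>
  Close pairs are controlled by the Lipschitz bound and distant pairs by the bound on \<open>|u|\<close>.  The
  difference vanishes unless one of the points is in the support; enlarging the radius by \<open>1\<close> puts
  both points of a close pair into the ball where the Lipschitz bound is available.
\<close>

lemma test_function_difference_bound:
  fixes u :: "real ^ 'n::finite \<Rightarrow> real"
  assumes "smooth u" and supp: "\<And>x. u x \<noteq> 0 \<Longrightarrow> norm x \<le> R"
  obtains C where "C \<ge> 0" "\<And>x y. \<bar>u x - u y\<bar>\<^sup>2 \<le>
    C * (min 1 ((norm (x - y))\<^sup>2) * (indicator (cball 0 (R + 1)) x + indicator (cball 0 (R + 1)) y))"
proof -
  let ?B = "cball 0 (R + 1) :: (real ^ 'n) set"
  obtain L where L: "\<And>x y. x \<in> ?B \<Longrightarrow> y \<in> ?B \<Longrightarrow> \<bar>u x - u y\<bar> \<le> L * norm (x - y)"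
    using smooth_Lipschitz_on_cball[OF assms(1)] by blast
  have "bounded (u ` ?B)"
    using assms by (intro compact_imp_bounded compact_continuous_image smooth_continuous_on) auto
  then obtain M where "M > 0" and M': "\<And>x. x \<in> ?B \<Longrightarrow> \<bar>u x\<bar> \<le> M"
    by (auto simp: bounded_pos)
  have M: "\<bar>u x\<bar> \<le> M" for x
    using M'[of x] supp[of x] \<open>M > 0\<close> by (cases "u x = 0") auto
  define C where "C = L\<^sup>2 + (2 * M)\<^sup>2"
  have "\<bar>u x - u y\<bar>\<^sup>2 \<le> C * (min 1 ((norm (x - y))\<^sup>2) * (indicator ?B x + indicator ?B y))" for x y
  proof (cases "u x = 0 \<and> u y = 0")
    case True
    then show ?thesis by (simp add: C_def)
  next
    case False
    then have near: "norm x \<le> R \<or> norm y \<le> R" using supp by blast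
    have "\<bar>u x - u y\<bar>\<^sup>2 \<le> C * min 1 ((norm (x - y))\<^sup>2)"
    proof (cases "norm (x - y) \<le> 1")
      case True
      have "norm x \<le> norm (x - y) + norm y" "norm y \<le> norm (x - y) + norm x"
        by (metis norm_triangle_sub add.commute, metis norm_triangle_sub add.commute norm_minus_commute)
      then have "x \<in> ?B" "y \<in> ?B" using near True by auto
      then have "\<bar>u x - u y\<bar>\<^sup>2 \<le> (L * norm (x - y))\<^sup>2"
        using L by (intro power_mono) auto
      also have "\<dots> \<le> C * (norm (x - y))\<^sup>2"
        unfolding C_def power_mult_distrib by (intro mult_right_mono) auto
      finally show ?thesis using True by (simp add: power_le_one)
    next
      case False
      have "\<bar>u x - u y\<bar>\<^sup>2 \<le> (2 * M)\<^sup>2"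
        using M[of x] M[of y] by (intro power_mono) auto
      also have "\<dots> \<le> C" by (simp add: C_def)
      finally show ?thesis using False by (simp add: one_le_power)
    qed
    also have "\<dots> \<le> C * min 1 ((norm (x - y))\<^sup>2) * (indicator ?B x + indicator ?B y)"
    proof -
      have "1 \<le> (indicator ?B x + indicator ?B y :: real)"
        using near by (auto simp: indicator_def)
      then show ?thesis
        using mult_left_mono[of 1 "indicator ?B x + indicator ?B y" "C * min 1 ((norm (x - y))\<^sup>2)"]
        by (simp add: C_def)
    qed
    finally show ?thesis by (simp add: mult.assoc)
  qed
  moreover have "C \<ge> 0" by (simp add: C_def)
  ultimately show ?thesis using that by blast
qed

text \<open>
  The difference quotient is dominated by an integrable function of \<open>x - y\<close>, localised to pairs
  with a point in a fixed ball.
\<close>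

lemma gagliardo_sq_finite:
  fixes u :: "real ^ 'n::finite \<Rightarrow> real"
  assumes "2 \<le> CARD('n)" "0 < s" "s < 1" "u \<in> test_functions \<Omega>"
  shows "gagliardo_sq k s u < \<infinity>"
proof -
  let ?e = "real CARD('n) + 2 * s"
  obtain R where supp: "\<And>x. u x \<noteq> 0 \<Longrightarrow> norm x \<le> R"
    using test_function_bounded_support[OF assms(4)] by blast
  let ?B = "cball 0 (R + 1) :: (real ^ 'n) set"
  obtain C where C: "C \<ge> 0" "\<And>x y. \<bar>u x - u y\<bar>\<^sup>2 \<le>
      C * (min 1 ((norm (x - y))\<^sup>2) * (indicator ?B x + indicator ?B y))"
    using test_function_difference_bound[OF test_function_smooth[OF assms(4)] supp] by blast
  define \<kappa> where "\<kappa> z = ennreal (min 1 ((norm z)\<^sup>2) / norm z powr ?e)" for z :: "real ^ 'n"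
  have \<kappa> [measurable]: "\<kappa> \<in> borel_measurable borel"
    unfolding \<kappa>_def by measurable
  have [measurable]: "?B \<in> sets borel"
    by (intro borel_closed closed_cball)
  have "(\<integral>\<^sup>+y. \<integral>\<^sup>+x. ennreal (\<bar>u x - u y\<bar>\<^sup>2 / norm (x - y) powr ?e) \<partial>lborel \<partial>lborel)
    \<le> (\<integral>\<^sup>+y. \<integral>\<^sup>+x. ennreal C * (\<kappa> (x - y) * (indicator ?B x + indicator ?B y)) \<partial>lborel \<partial>lborel)"
  proof (intro nn_integral_mono)
    fix x y :: "real ^ 'n"
    have "\<bar>u x - u y\<bar>\<^sup>2 / norm (x - y) powr ?e \<le>
        C * (min 1 ((norm (x - y))\<^sup>2) / norm (x - y) powr ?e * (indicator ?B x + indicator ?B y))"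
      using divide_right_mono[OF C(2)[of x y], of "norm (x - y) powr ?e"] by simp
    then have "ennreal (\<bar>u x - u y\<bar>\<^sup>2 / norm (x - y) powr ?e) \<le> ennreal
        (C * (min 1 ((norm (x - y))\<^sup>2) / norm (x - y) powr ?e * (indicator ?B x + indicator ?B y)))"
      by (rule ennreal_leI)
    also have "\<dots> = ennreal C * (\<kappa> (x - y) * (indicator ?B x + indicator ?B y))"
    proof -
      have split: "ennreal (C * (a * (indicator ?B x + indicator ?B y))) =
          ennreal C * (ennreal a * (indicator ?B x + indicator ?B y))" if "a \<ge> 0" for a
        using C(1) that by (simp add: ennreal_mult ennreal_plus ennreal_indicator)
      show ?thesis
        unfolding \<kappa>_def by (rule split) simp
    qed
    finally show "ennreal (\<bar>u x - u y\<bar>\<^sup>2 / norm (x - y) powr ?e) \<le>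
      ennreal C * (\<kappa> (x - y) * (indicator ?B x + indicator ?B y))" .
  qed
  also have "\<dots> = ennreal C *
      (\<integral>\<^sup>+y. \<integral>\<^sup>+x. \<kappa> (x - y) * (indicator ?B x + indicator ?B y) \<partial>lborel \<partial>lborel)"
    by ((subst nn_integral_cmult, measurable)+)
  also have "\<dots> = ennreal C * (2 * (emeasure lborel ?B * (\<integral>\<^sup>+z. \<kappa> z \<partial>lborel)))"
    by (subst double_nn_integral_kernel_near_set[OF \<kappa>]) (simp_all add: \<kappa>_def)
  also have "\<dots> < \<infinity>"
    using nn_integral_truncated_kernel[where 'a = "real ^ 'n", of s] assms
      emeasure_lborel_cball_finite[of "0 :: real ^ 'n" "R + 1"]
    by (simp add: \<kappa>_def ennreal_mult_less_top)
  finally have "(\<integral>\<^sup>+y. \<integral>\<^sup>+x. ennreal (\<bar>u x - u y\<bar>\<^sup>2 / norm (x - y) powr ?e) \<partial>lborel \<partial>lborel) < \<infinity>" .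
  moreover have "inverse 2 < (top :: ennreal)"
    by (simp add: less_top[symmetric])
  ultimately show ?thesis
    using frac_const_finite[of k s]
    by (simp add: gagliardo_sq_def ennreal_mult_less_top divide_ennreal_def)
qed

section \<open>Equality of the mixed and the classical constant\<close>

theorem theorem1p2:
  fixes \<Omega> :: "(real ^ 'n::finite) set"
    and k :: 'n
    and s \<mu> :: real
  assumes "CARD('n) \<ge> 3"
    and "0 < \<mu>" and "\<mu> < real CARD('n)"
    and "0 < s" and "s < 1"
    and "open \<Omega>" and "\<Omega> \<noteq> {}"
  shows "S_HLM k s \<mu> \<Omega> = S_HLC TYPE('n) \<mu>"
proof (rule antisym)
  have mixed: "(mixed_norm k s u)\<^sup>2 = dirichlet_sq u + gagliardo_sq k s u" for u :: "real ^ 'n \<Rightarrow> real"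
    by (simp add: mixed_norm_def ennpowr_half_power2)
  \<comment> \<open>The mixed energy is larger, and the class of competitors is smaller.\<close>
  show "S_HLC TYPE('n) \<mu> \<le> S_HLM k s \<mu> \<Omega>"
    unfolding S_HLC_def S_HLM_def
    by (rule INF_mono) (auto simp: mixed test_functions_def intro!: divide_right_mono_ennreal bexI)
  show "S_HLM k s \<mu> \<Omega> \<le> S_HLC TYPE('n) \<mu>"
    unfolding S_HLC_def
  proof (rule INF_greatest)
    fix u :: "real ^ 'n \<Rightarrow> real"
    assume u: "u \<in> test_functions UNIV - {\<lambda>_. 0}"
    then have sm: "smooth u" and nz: "u \<noteq> (\<lambda>_. 0)"
      by (auto simp: test_function_smooth)
    obtain R where "R > 0" and supp: "\<And>x. u x \<noteq> 0 \<Longrightarrow> norm x \<le> R"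
      using u test_function_bounded_support by blast
    obtain c \<epsilon> where "\<epsilon> > 0" and ball: "cball c \<epsilon> \<subseteq> \<Omega>"
      using assms(6,7) by (meson equals0I open_contains_cball)
    let ?D = "dirichlet_sq u" and ?G = "gagliardo_sq k s u" and ?H = "(hl_norm \<mu> u)\<^sup>2"
    let ?q = "\<lambda>r. ?D / ?H + ennreal (r powr (2 - 2 * s)) * (?G / ?H)"
    have "?G \<noteq> top"
      unfolding less_top using gagliardo_sq_finite[of s u UNIV k] u assms by simp
    \<comment> \<open>The quotient \<open>?G / ?H\<close> is finite also when \<open>?H = \<infinity>\<close>, since it is then \<open>0\<close>.\<close>
    then have "?G / ?H \<noteq> top"
      using hl_norm_nonzero[OF sm nz, of \<mu>] by (simp add: ennreal_divide_eq_top_iff)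
    \<comment> \<open>The quotient of \<open>u\<close> shrunk by \<open>r\<close> towards \<open>c\<close>; the common factor \<open>?a\<close> of the Dirichlet term
      and the denominator cancels.\<close>
    have upper: "S_HLM k s \<mu> \<Omega> \<le> ?q r" if r: "0 < r" "r < \<epsilon> / R" for r
    proof -
      let ?v = "rescale c r u" and ?a = "ennreal (r powr (real CARD('n) - 2))"
      have "cball c (r * R) \<subseteq> \<Omega>"
        using r \<open>R > 0\<close> ball by (auto simp: field_simps)
      then have "?v \<in> test_functions \<Omega> - {\<lambda>_. 0}"
        using rescale_test_function[OF sm supp] rescale_nonzero[OF nz] r by auto
      then have "S_HLM k s \<mu> \<Omega> \<le> (mixed_norm k s ?v)\<^sup>2 / (hl_norm \<mu> ?v)\<^sup>2"
        unfolding S_HLM_def by (rule INF_lower)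
      also have "(mixed_norm k s ?v)\<^sup>2 = ?a * ?D + ennreal (r powr (real CARD('n) - 2 * s)) * ?G"
        using r sm by (simp add: mixed dirichlet_sq_rescale gagliardo_sq_rescale)
      also have "ennreal (r powr (real CARD('n) - 2 * s)) = ennreal (r powr (2 - 2 * s)) * ?a"
        by (simp add: ennreal_mult[symmetric] powr_add[symmetric])
      also have "?a * ?D + ennreal (r powr (2 - 2 * s)) * ?a * ?G =
          (?D + ennreal (r powr (2 - 2 * s)) * ?G) * ?a"
        by (simp add: distrib_left mult_ac)
      also have "(hl_norm \<mu> ?v)\<^sup>2 = ?H * ?a"
        using hl_norm_rescale[OF sm r(1) assms(1,3)] by (simp add: mult.commute)
      also have "(?D + ennreal (r powr (2 - 2 * s)) * ?G) * ?a / (?H * ?a) =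
          (?D + ennreal (r powr (2 - 2 * s)) * ?G) / ?H"
        using r by (intro divide_mult_eq) auto
      finally show ?thesis
        by (simp add: add_divide_distrib_ennreal ennreal_times_divide)
    qed
    have "((\<lambda>r. r powr (2 - 2 * s)) \<longlongrightarrow> 0) (at_right (0::real))"
      using assms(5) by (intro tendsto_zero_powrI[where b = "2 - 2 * s"]) (auto simp: eventually_at_filter)
    then have "((\<lambda>r. ennreal (r powr (2 - 2 * s))) \<longlongrightarrow> ennreal 0) (at_right 0)"
      by (rule tendsto_ennrealI)
    then have "((\<lambda>r. (?G / ?H) * ennreal (r powr (2 - 2 * s))) \<longlongrightarrow> (?G / ?H) * ennreal 0) (at_right 0)"
      using \<open>?G / ?H \<noteq> top\<close> unfolding less_top by (rule ennreal_tendsto_cmult[rotated])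
    then have "((\<lambda>r. ?D / ?H + (?G / ?H) * ennreal (r powr (2 - 2 * s))) \<longlongrightarrow> ?D / ?H + (?G / ?H) * ennreal 0) (at_right 0)"
      by (intro tendsto_add tendsto_const)
    then have "(?q \<longlongrightarrow> ?D / ?H) (at_right 0)"
      by (simp add: mult.commute)
    moreover have "eventually (\<lambda>r. S_HLM k s \<mu> \<Omega> \<le> ?q r) (at_right 0)"
      unfolding eventually_at_right_field
      using upper \<open>\<epsilon> > 0\<close> \<open>R > 0\<close> by (intro exI[of _ "\<epsilon> / R"]) auto
    ultimately show "S_HLM k s \<mu> \<Omega> \<le> ?D / ?H"
      by (rule tendsto_lowerbound) simp
  qed
qed

end
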